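(* Assume (PD) has a solution. Let $$\psi_p=\inf_{x^*\in\Omega^P}\ \min_{i\notin\mathcal{A}(x^* )}x^*_i$$ and assume $0<\psi_p<\infty$. Fix $\lambda\in\mathbb{R}^n$, $\lambda\ge0$, and $C$ such that $$0<\|\lambda\|<\min\left(1,\frac{\psi_p}{16\max(\tau_p,\tau_d)}\right)\quad\text{and}\quad C=\frac{\psi_p}{2}.$$ Let $(x,y,s)\in\mathcal{F}^0_\lambda$ with $\mu_\lambda=\frac{(x+\lambda)^T(s+\lambda)}{n}$ sufficiently small, namely $$\mu_\lambda<\frac{\psi_p}{4C_2\max(\tau_p,\tau_d)}.$$ Then there exists a solution $(x^*,y^*,s^* )$ of (PD) such that $\bar{\mathcal{A}}(x)=\mathcal{A}(x^* )$.
   Context: Vector inequalities are componentwise; $\|\cdot\|$ is the Euclidean norm; $A\in\mathbb{R}^{m\times n}$ ($m\le n$), $b\in\mathbb{R}^m$, $c\in\mathbb{R}^n$. A minimum over an empty index set is $+\infty$. (PD): minimize $c^Tx$ s.t. $Ax=b$, $x\ge 0$; and its dual, maximize $b^Ty$ s.t. $A^Ty+s=c$, $s\ge0$. $\Omega^P$ is the solution set of the primal problem. A solution of (PD) is a triple $(x^*,y^*,s^* )$ with $x^*$ primal optimal and $(y^*,s^* )$ dual optimal. For $\lambda\ge0$, (PD$_\lambda$): minimize $(c+\lambda)^T(x+\lambda)$ s.t. $Ax=b$, $x\ge-\lambda$; and its dual, maximize $(b+A\lambda)^Ty$ s.t. $A^Ty+s=c$, $s\ge-\lambda$. Its set of strictly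 feasible points is $\mathcal{F}^0_\lambda=\{(x,y,s): Ax=b,\ A^Ty+s=c,\ x+\lambda>0,\ s+\lambda>0\}$. Let $\Omega^P_\lambda$ and $\Omega^D_\lambda$ be the primal and dual solution sets of (PD$_\lambda$), and let $(\mathcal{A}_\lambda,\mathcal{I}_\lambda)$ be the strictly complementary partition of $\{1,\dots,n\}$: $\mathcal{I}_\lambda=\{i: x_i+\lambda_i>0 \text{ for some } x\in\Omega^P_\lambda\}$, $\mathcal{A}_\lambda=\{i: s_i+\lambda_i>0\text{ for some }(y,s)\in\Omega^D_\lambda\}$. With $b_\lambda=b+A\lambda$, $c_\lambda=c+\lambda$, define $$\epsilon(A,b_\lambda,c_\lambda)=\min\Big(\min_{i\in\mathcal{I}_\lambda}\sup_{x\in\Omega^P_\lambda}(x_i+\lambda_i),\ \min_{i\in\mathcal{A}_\lambda}\sup_{(y,s)\in\Omega^D_\lambda}(s_i+\lambda_i)\Big)>0,\qquad C_2=\frac{n\sqrt n}{\epsilon(A,b_\lambda,c_\lambda)}+n .$$ $\tau_p,\tau_d>0$ are fixed constants depending only on $(A,b,c)$ with the property (such constants exist) that for every $\lambda\ge0$ and every $(x,y,s)\in\mathcal{F}^0_\lambda$ there is a solution $(x^*,y^*,s^* )$ of (PD) with $$\|x-x^*\|<\tau_p\big(C_2\mu_\lambda+4\|\lambda\|\max(\|\lambda\|,1)\big),\qquad \|s-s^*\|<\tau_d\big(C_2\mu_\lambda+4\|\lambda\|\max(\|\lambda\|,1)\big),$$ where $\mu_\lambda=(x+\lambda)^T(s+\lambda)/n$.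 $\mathcal{A}(x^* )=\{i\in\{1,\dots,n\}:x^*_i=0\}$; the predicted active set with threshold $C$ is $\bar{\mathcal{A}}(x)=\{i\in\{1,\dots,n\}:x_i<C\}$. *)

theory Defs
  imports "HOL-Analysis.Analysis"
begin

definition primal_sols :: "real^'n^'m \<Rightarrow> real^'m \<Rightarrow> real^'n \<Rightarrow> (real^'n) set"
  where "primal_sols A b c = {x. is_arg_min (\<lambda>x. c \<bullet> x) (\<lambda>x. A *v x = b \<and> 0 \<le> x) x}"

definition dual_sols :: "real^'n^'m \<Rightarrow> real^'m \<Rightarrow> real^'n \<Rightarrow> ((real^'m) \<times> (real^'n)) set"
  where "dual_sols A b c =
    {ys. is_arg_max (\<lambda>(y, s). b \<bullet> y) (\<lambda>(y, s). transpose A *v y + s = c \<and> 0 \<le> s) ys}"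

definition PD_sols :: "real^'n^'m \<Rightarrow> real^'m \<Rightarrow> real^'n \<Rightarrow> ((real^'n) \<times> (real^'m) \<times> (real^'n)) set"
  where "PD_sols A b c = {(x, y, s). x \<in> primal_sols A b c \<and> (y, s) \<in> dual_sols A b c}"

definition pert_primal_sols ::
    "real^'n^'m \<Rightarrow> real^'m \<Rightarrow> real^'n \<Rightarrow> real^'n \<Rightarrow> (real^'n) set"
  where "pert_primal_sols A b c l =
    {x. is_arg_min (\<lambda>x. (c + l) \<bullet> (x + l)) (\<lambda>x. A *v x = b \<and> - l \<le> x) x}"

definition pert_dual_sols ::
    "real^'n^'m \<Rightarrow> real^'m \<Rightarrow> real^'n \<Rightarrow> real^'n \<Rightarrow> ((real^'m) \<times> (real^'n)) set"
  where "pert_dual_sols A b c l =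
    {ys. is_arg_max (\<lambda>(y, s). (b + A *v l) \<bullet> y)
           (\<lambda>(y, s). transpose A *v y + s = c \<and> - l \<le> s) ys}"

(* Strict positivity is written out componentwise because (<) on vectors is only
   the strict part of the componentwise (\<le>). *)
definition strictly_feasible ::
    "real^'n^'m \<Rightarrow> real^'m \<Rightarrow> real^'n \<Rightarrow> real^'n \<Rightarrow> ((real^'n) \<times> (real^'m) \<times> (real^'n)) set"
  where "strictly_feasible A b c l =
    {(x, y, s). A *v x = b \<and> transpose A *v y + s = c \<and>
       (\<forall>i. 0 < (x + l) $ i) \<and> (\<forall>i. 0 < (s + l) $ i)}"

definition inactive_part ::
    "real^'n^'m \<Rightarrow> real^'m \<Rightarrow> real^'n \<Rightarrow> real^'n \<Rightarrow> 'n set"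
  where "inactive_part A b c l = {i. \<exists>x \<in> pert_primal_sols A b c l. 0 < x $ i + l $ i}"

definition active_part ::
    "real^'n^'m \<Rightarrow> real^'m \<Rightarrow> real^'n \<Rightarrow> real^'n \<Rightarrow> 'n set"
  where "active_part A b c l = {i. \<exists>(y, s) \<in> pert_dual_sols A b c l. 0 < s $ i + l $ i}"

(* Extended reals: the infimum over an empty index set is \<infinity>, and on a nonempty
   finite index set it is the minimum. *)
definition eps_pert ::
    "real^'n^'m \<Rightarrow> real^'m \<Rightarrow> real^'n \<Rightarrow> real^'n \<Rightarrow> ereal"
  where "eps_pert A b c l =
    min (INF i \<in> inactive_part A b c l. SUP x \<in> pert_primal_sols A b c l. ereal (x $ i + l $ i))
        (INF i \<in> active_part A b c l. SUP (y, s) \<in> pert_dual_sols A b c l. ereal (s $ i + l $ i))"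

(* eps_pert is always positive, so the quotient below is finite (and 0 if eps_pert = \<infinity>);
   real_of_ereal merely converts its type. *)
definition C2 :: "real^'n^'m \<Rightarrow> real^'m \<Rightarrow> real^'n \<Rightarrow> real^'n \<Rightarrow> real"
  where "C2 A b c l =
    real_of_ereal (ereal (real CARD('n) * sqrt (real CARD('n))) / eps_pert A b c l)
      + real CARD('n)"

definition mu :: "real^'n \<Rightarrow> real^'n \<Rightarrow> real^'n \<Rightarrow> real"
  where "mu l x s = ((x + l) \<bullet> (s + l)) / real CARD('n)"

definition error_bound_constants ::
    "real^'n^'m \<Rightarrow> real^'m \<Rightarrow> real^'n \<Rightarrow> real \<Rightarrow> real \<Rightarrow> bool"
  where "error_bound_constants A b c \<tau>p \<tau>d \<longleftrightarrow>
    0 < \<tau>p \<and> 0 < \<tau>d \<and>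
    (\<forall>l \<ge> 0. \<forall>(x, y, s) \<in> strictly_feasible A b c l. \<exists>(x', y', s') \<in> PD_sols A b c.
       norm (x - x') < \<tau>p * (C2 A b c l * mu l x s + 4 * norm l * max (norm l) 1) \<and>
       norm (s - s') < \<tau>d * (C2 A b c l * mu l x s + 4 * norm l * max (norm l) 1))"

definition active_set :: "real^'n \<Rightarrow> 'n set"
  where "active_set x = {i. x $ i = 0}"

definition predicted_active_set :: "real \<Rightarrow> real^'n \<Rightarrow> 'n set"
  where "predicted_active_set C x = {i. x $ i < C}"

definition psi_p :: "real^'n^'m \<Rightarrow> real^'m \<Rightarrow> real^'n \<Rightarrow> ereal"
  where "psi_p A b c = (INF x \<in> primal_sols A b c. INF i \<in> - active_set x. ereal (x $ i))"

end

theory Submission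
  imports Defs
begin

text \<open>
  The error bound places some solution \<open>x'\<close> of (PD) within \<open>\<psi> / 2\<close> of \<open>x\<close>: as
  \<open>norm l < 1\<close>, the bound reads \<open>\<tau>p * (C2 * \<mu> + 4 * norm l)\<close>, and the hypotheses on \<open>\<mu>\<close> and
  on \<open>norm l\<close> each limit one of the two terms to \<open>\<psi> / (4 * max \<tau>p \<tau>d)\<close>. By the definition of
  \<open>\<psi>\<close>, no component of a primal solution lies strictly between \<open>0\<close> and \<open>\<psi>\<close>. A perturbation of
  less than \<open>\<psi> / 2\<close> therefore keeps zero components below the threshold \<open>\<psi> / 2\<close> and all others
  above it, so thresholding \<open>x\<close> recovers exactly the zeros of \<open>x'\<close>.

  The hypothesis on \<open>\<mu>\<close> divides by \<open>C2\<close>, so it bounds \<open>C2 * \<mu>\<close> only because \<open>C2\<close> is positive;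
  the lemma \<open>C2_pos\<close> supplies this.
\<close>

text \<open>
  By definition, each index of either part of the partition has a solution at which its shifted
  component is positive, so every supremum is at least a positive number.
\<close>

lemma eps_pert_nonneg: "0 \<le> eps_pert A b c l"
proof -
  have "0 \<le> (SUP x \<in> pert_primal_sols A b c l. ereal (x $ i + l $ i))"
    if i: "i \<in> inactive_part A b c l" for i
  proof -
    obtain x where "x \<in> pert_primal_sols A b c l" "0 < x $ i + l $ i"
      using i by (auto simp: inactive_part_def)
    then show ?thesis
      by (intro SUP_upper2[of x]) auto
  qed
  moreover have "0 \<le> (SUP (y, s) \<in> pert_dual_sols A b c l. ereal (s $ i + l $ i))"
    if i: "i \<in> active_part A b c l" for i
  proof -
    obtain y s where "(y, s) \<in> pert_dual_sols A b c l" "0 < s $ i + l $ i"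
      using i by (auto simp: active_part_def)
    then show ?thesis
      by (intro SUP_upper2[of "(y, s)"]) auto
  qed
  ultimately show ?thesis
    unfolding eps_pert_def by (intro min.boundedI INF_greatest)
qed

text \<open>
  Nonnegativity of \<open>eps_pert\<close> is enough: the quotient in \<open>C2\<close> is then nonnegative as an extended
  real, and \<open>real_of_ereal\<close> preserves this, also at \<open>\<infinity>\<close>. The summand \<open>CARD('n)\<close> makes the sum
  strictly positive.
\<close>

lemma C2_pos:
  fixes A :: "real^'n^'m"
  shows "0 < C2 A b c l"
proof -
  have "0 \<le> ereal (real CARD('n) * sqrt (real CARD('n))) / eps_pert A b c l"
    unfolding divide_ereal_def
    by (intro ereal_0_le_mult inverse_ereal_ge0I eps_pert_nonneg) simp_all
  then show ?thesis
    unfolding C2_def by (intro add_nonneg_pos real_of_ereal_pos) simp_all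
qed

lemma psi_p_le_component:
  assumes "x \<in> primal_sols A b c" and "x $ i \<noteq> 0"
  shows "psi_p A b c \<le> ereal (x $ i)"
  unfolding psi_p_def
  using assms by (intro INF_lower2[of x] INF_lower2[of i]) (auto simp: active_set_def)

lemma predicted_active_set_half_gap:
  fixes x x' :: "real^'n"
  assumes close: "norm (x - x') < \<psi> / 2"
    and gap: "\<And>i. x' $ i \<noteq> 0 \<Longrightarrow> \<psi> \<le> x' $ i"
  shows "predicted_active_set (\<psi> / 2) x = active_set x'"
proof -
  have "x $ i < \<psi> / 2 \<longleftrightarrow> x' $ i = 0" for i
  proof -
    have "\<bar>x $ i - x' $ i\<bar> < \<psi> / 2"
      using component_le_norm_cart[of "x - x'" i] close by simp
    then show ?thesis
      using gap[of i] by linarith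
  qed
  then show ?thesis
    by (simp add: predicted_active_set_def active_set_def)
qed

theorem theorem5:
  fixes A :: "real^'n^'m" and b :: "real^'m" and c :: "real^'n"
    and l x s :: "real^'n" and y :: "real^'m" and \<tau>p \<tau>d \<psi> C :: real
  assumes "CARD('m) \<le> CARD('n)"
    and "error_bound_constants A b c \<tau>p \<tau>d"
    and "PD_sols A b c \<noteq> {}"
    and "0 < psi_p A b c" and "psi_p A b c < \<infinity>" and "\<psi> = real_of_ereal (psi_p A b c)"
    and "0 \<le> l"
    and "0 < norm l" and "norm l < min 1 (\<psi> / (16 * max \<tau>p \<tau>d))"
    and "C = \<psi> / 2"
    and "(x, y, s) \<in> strictly_feasible A b c l"
    and "mu l x s < \<psi> / (4 * C2 A b c l * max \<tau>p \<tau>d)"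
  shows "\<exists>(x', y', s') \<in> PD_sols A b c. predicted_active_set C x = active_set x'"
proof -
  define t where "t = max \<tau>p \<tau>d"
  define K where "K = C2 A b c l * mu l x s + 4 * norm l"
  have \<tau>p: "0 < \<tau>p"
    using assms(2) by (simp add: error_bound_constants_def)
  have t: "0 < t" "\<tau>p \<le> t"
    using \<tau>p by (auto simp: t_def)
  have psi: "psi_p A b c = ereal \<psi>"
    using assms(4-6) by (cases "psi_p A b c") auto
  then have "0 < \<psi>"
    using assms(4) by simp
  obtain x' y' s' where sol: "(x', y', s') \<in> PD_sols A b c"
    and "norm (x - x') < \<tau>p * (C2 A b c l * mu l x s + 4 * norm l * max (norm l) 1)"
    using assms(2,7,11) unfolding error_bound_constants_def by blast
  moreover have "max (norm l) 1 = 1"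
    using assms(9) by simp
  ultimately have bound: "norm (x - x') < \<tau>p * K"
    by (simp add: K_def)
  have "C2 A b c l * mu l x s < \<psi> / (4 * t)"
    using assms(12) C2_pos[of A b c l] t by (simp add: t_def[symmetric] field_simps)
  moreover have "4 * norm l < \<psi> / (4 * t)"
    using assms(9) t by (simp add: t_def[symmetric] field_simps)
  ultimately have K: "K < \<psi> / (2 * t)"
    by (simp add: K_def field_simps)
  have "\<tau>p * K < \<tau>p * (\<psi> / (2 * t))"
    using K \<tau>p by (rule mult_strict_left_mono)
  also have "\<dots> \<le> t * (\<psi> / (2 * t))"
    using t \<open>0 < \<psi>\<close> by (intro mult_right_mono) simp_all
  also have "\<dots> = \<psi> / 2"
    using t by simp
  finally have "norm (x - x') < \<psi> / 2"
    using bound by simp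
  moreover have "\<psi> \<le> x' $ i" if "x' $ i \<noteq> 0" for i
    using psi_p_le_component[of x' A b c i] that sol psi by (simp add: PD_sols_def)
  ultimately have "predicted_active_set C x = active_set x'"
    unfolding assms(10) by (rule predicted_active_set_half_gap)
  then show ?thesis
    using sol by blast
qed

end
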